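(* Let $\nu,\omega>0$ and let $\{N_1(t),\,t\ge0\}$ and $\{N_2(t),\,t\ge0\}$ be independent homogeneous Poisson processes with parameters $\nu$ and $\omega$, respectively. Then the iterated Poisson process $\hat N(t):=N_1(N_2(t))$, $t\ge0$, is a Bell-Touchard process with parameters $\alpha:=\omega e^{-\nu}$ and $\theta:=\nu$.
   Context: $\mathbb{N}=\{1,2,\dots\}$, $\mathbb{N}_0=\mathbb{N}\cup\{0\}$. A counting process $\{N(t),t\ge0\}$ is an $\mathbb{N}_0$-valued stochastic process where $N(t)$ is the number of events that have occurred up to time $t$ (so it is nondecreasing in $t$). A function $f:\mathbb{R}\to\mathbb{R}$ is $o(s)$ if $\lim_{s\to0}f(s)/s=0$. A counting process is a Bell-Touchard process with parameters $(\alpha,\theta)$, $\alpha,\theta>0$, if (1) $N(0)=0$; (2) it has stationary and independent increments; (3) $\Pr[N(t+s)-N(t)=k]=\alpha s\,\theta^k/k!+o(s)$ for every $k\in\mathbb{N}$ and $s,t>0$. *)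

theory Defs
  imports "HOL-Probability.Probability"
begin

text \<open>
  A process is a map \<open>N :: real \<Rightarrow> 'a \<Rightarrow> nat\<close>, where \<open>N t x\<close> is the value at time \<open>t\<close> on the
  outcome \<open>x\<close>; only the times \<open>t \<ge> 0\<close> are relevant.
\<close>

context prob_space
begin

definition counting_process :: "(real \<Rightarrow> 'a \<Rightarrow> nat) \<Rightarrow> bool" where
  "counting_process N \<longleftrightarrow>
     (\<forall>t\<ge>0. N t \<in> measurable M (count_space UNIV)) \<and>
     (\<forall>x\<in>space M. mono_on {0..} (\<lambda>t. N t x))"

text \<open>
  The subtraction of natural numbers below is not truncated when \<open>N\<close> is a counting process, which
  is the only case in which these notions are used.
\<close>

definition independent_increments :: "(real \<Rightarrow> 'a \<Rightarrow> nat) \<Rightarrow> bool" where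
  "independent_increments N \<longleftrightarrow>
     (\<forall>(n::nat) (t::nat \<Rightarrow> real). 0 \<le> t 0 \<longrightarrow> (\<forall>i<n. t i \<le> t (Suc i)) \<longrightarrow>
        indep_vars (\<lambda>_. count_space UNIV) (\<lambda>i x. N (t (Suc i)) x - N (t i) x) {..<n})"

definition stationary_increments :: "(real \<Rightarrow> 'a \<Rightarrow> nat) \<Rightarrow> bool" where
  "stationary_increments N \<longleftrightarrow>
     (\<forall>s\<ge>0. \<forall>t\<ge>0. \<forall>u\<ge>0.
        distr M (count_space UNIV) (\<lambda>x. N (t + s) x - N t x) =
        distr M (count_space UNIV) (\<lambda>x. N (u + s) x - N u x))"

definition poisson_process :: "real \<Rightarrow> (real \<Rightarrow> 'a \<Rightarrow> nat) \<Rightarrow> bool" where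
  "poisson_process r N \<longleftrightarrow>
     r > 0 \<and>
     counting_process N \<and>
     (\<forall>x\<in>space M. N 0 x = 0) \<and>
     independent_increments N \<and>
     (\<forall>t\<ge>0. \<forall>s>0. distr M (count_space UNIV) (\<lambda>x. N (t + s) x - N t x) =
                  measure_pmf (poisson_pmf (r * s)))"

text \<open>
  In the last clause \<open>f\<close> is the error term \<open>o(s)\<close>; its values at \<open>s \<le> 0\<close> are unconstrained by the
  equation.
\<close>

definition bell_touchard_process :: "real \<Rightarrow> real \<Rightarrow> (real \<Rightarrow> 'a \<Rightarrow> nat) \<Rightarrow> bool" where
  "bell_touchard_process \<alpha> \<theta> N \<longleftrightarrow>
     \<alpha> > 0 \<and> \<theta> > 0 \<and>
     counting_process N \<and>
     (\<forall>x\<in>space M. N 0 x = 0) \<and>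
     stationary_increments N \<and>
     independent_increments N \<and>
     (\<forall>k\<ge>1. \<forall>t>0. \<exists>f :: real \<Rightarrow> real. ((\<lambda>s. f s / s) \<longlongrightarrow> 0) (at 0) \<and>
        (\<forall>s>0. prob {x \<in> space M. N (t + s) x - N t x = k} = \<alpha> * s * \<theta> ^ k / fact k + f s))"

text \<open>Independence of the two processes as random paths, not merely at each fixed time.\<close>

definition independent_processes ::
    "(real \<Rightarrow> 'a \<Rightarrow> nat) \<Rightarrow> (real \<Rightarrow> 'a \<Rightarrow> nat) \<Rightarrow> bool" where
  "independent_processes X Y \<longleftrightarrow>
     indep_var (PiM {0..} (\<lambda>_. count_space UNIV)) (\<lambda>x. \<lambda>t\<in>{0..}. X t x)
               (PiM {0..} (\<lambda>_. count_space UNIV)) (\<lambda>x. \<lambda>t\<in>{0..}. Y t x)"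

end

end

theory Submission
  imports Defs "HOL-Real_Asymp.Real_Asymp"
begin

text \<open>
  The idea is to freeze the path of \<open>N2\<close>. Along a partition \<open>t\<^sub>0 \<le> \<dots> \<le> t\<^sub>n\<close> the values
  \<open>N2 t\<^sub>0 \<le> \<dots> \<le> N2 t\<^sub>n\<close> then form a fixed partition for \<open>N1\<close>, so that, conditionally on \<open>N2\<close>,
  the increments of the iterated process are independent Poisson variables whose rates are \<open>\<nu>\<close>
  times the increments of \<open>N2\<close>. As the two paths are independent, Fubini's theorem
  (\<open>emeasure_indep_var_eq_nn_integral\<close>) turns the joint probability of prescribed increments
  \<open>k\<^sub>0, \<dots>, k\<^bsub>n-1\<^esub>\<close> into the expectation over \<open>N2\<close> of the product of these Poisson weights. Its
  factors depend on disjoint increments of \<open>N2\<close>, which are independent, so the expectation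
  factorizes (\<open>iterated_poisson_emeasure_increments\<close>). The factor with index \<open>i\<close> is the weight of
  \<open>k\<^sub>i\<close> under a Poisson mixture of Poisson laws (\<open>iterated_law\<close>) that depends on the interval only
  through its length. The product form gives independent increments and the dependence on the
  length alone gives stationarity.

  For the behaviour at small times \<open>s\<close>, let \<open>m\<close> be the number of events of \<open>N2\<close> in the interval.
  If \<open>m = 0\<close>, the iterated process does not move, so this case contributes nothing to \<open>k \<ge> 1\<close>. The
  case \<open>m = 1\<close> has probability \<open>\<omega> s + o(s)\<close> and contributes the factor \<open>exp (- \<nu>) \<nu>\<^sup>k / k!\<close>, which
  yields the leading term. The case \<open>m \<ge> 2\<close> has probability \<open>o(s)\<close>.
\<close>

section \<open>Joint laws of independent random variables\<close>

text \<open>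
  Finite families with values in a countable type are again discrete, hence their joint law is
  determined by the mass of single points, and only these have to be compared with the product
  measure.
\<close>

lemma (in prob_space) indep_vars_count_spaceI:
  fixes X :: "'i \<Rightarrow> 'a \<Rightarrow> 'b::countable"
  assumes "finite I"
    and rv [measurable]: "\<And>i. i \<in> I \<Longrightarrow> X i \<in> measurable M (count_space UNIV)"
    and joint: "\<And>k. emeasure M {x \<in> space M. \<forall>i\<in>I. X i x = k i} =
                     (\<Prod>i\<in>I. emeasure M {x \<in> space M. X i x = k i})"
  shows "indep_vars (\<lambda>_. count_space UNIV) X I"
proof (cases "I = {}")
  case True
  then show ?thesis
    unfolding indep_vars_def indep_sets_def by simp
next
  case False
  define D where "D i = distr M (count_space UNIV) (X i)" for i
  have "distr M (\<Pi>\<^sub>M i\<in>I. count_space UNIV) (\<lambda>x. \<lambda>i\<in>I. X i x) = (\<Pi>\<^sub>M i\<in>I. D i)"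
  proof (rule measure_eqI_countable')
    show "countable (\<Pi>\<^sub>E i\<in>I. (UNIV :: 'b set))"
      using assms(1) by (intro countable_PiE) auto
    show "space (distr M (\<Pi>\<^sub>M i\<in>I. count_space UNIV) (\<lambda>x. \<lambda>i\<in>I. X i x)) = (\<Pi>\<^sub>E i\<in>I. UNIV)"
      "space (\<Pi>\<^sub>M i\<in>I. D i) = (\<Pi>\<^sub>E i\<in>I. UNIV)"
      by (simp_all add: space_PiM D_def)
    have sets_D: "sets (\<Pi>\<^sub>M i\<in>I. D i) = sets (\<Pi>\<^sub>M i\<in>I. count_space (UNIV :: 'b set))"
      by (intro sets_PiM_cong) (simp_all add: D_def)
    have single: "{k} \<in> sets (\<Pi>\<^sub>M i\<in>I. count_space (UNIV :: 'b set))"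
      if "k \<in> (\<Pi>\<^sub>E i\<in>I. UNIV)" for k
      using that assms(1) by (simp add: count_space_PiM_finite)
    show "{k} \<in> sets (distr M (\<Pi>\<^sub>M i\<in>I. count_space UNIV) (\<lambda>x. \<lambda>i\<in>I. X i x))"
      "{k} \<in> sets (\<Pi>\<^sub>M i\<in>I. D i)" if "k \<in> (\<Pi>\<^sub>E i\<in>I. UNIV)" for k
      using single[OF that] by (simp_all add: sets_D)
    fix k assume k: "k \<in> (\<Pi>\<^sub>E i\<in>I. (UNIV :: 'b set))"
    \<comment> \<open>Outside \<open>I\<close> the variables need not be measurable, so \<open>D\<close> is replaced there by an arbitrary
      probability measure: the product measure formula wants every component to be sigma-finite.\<close>
    define D' where "D' i = (if i \<in> I then D i else return (count_space UNIV) undefined)" for i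
    have "sigma_finite_measure (D' i)" for i
    proof (cases "i \<in> I")
      case True
      then show ?thesis
        unfolding D'_def D_def by (simp add: prob_space_imp_sigma_finite prob_space_distr rv)
    next
      case False
      then show ?thesis
        unfolding D'_def by (simp add: prob_space_imp_sigma_finite prob_space_return)
    qed
    then interpret D': product_sigma_finite D'
      by (rule product_sigma_finite.intro)
    have "emeasure (distr M (\<Pi>\<^sub>M i\<in>I. count_space UNIV) (\<lambda>x. \<lambda>i\<in>I. X i x)) {k} =
        emeasure M ((\<lambda>x. \<lambda>i\<in>I. X i x) -` {k} \<inter> space M)"
      by (intro emeasure_distr single k measurable_restrict) (auto simp: rv)
    also have "(\<lambda>x. \<lambda>i\<in>I. X i x) -` {k} \<inter> space M = {x \<in> space M. \<forall>i\<in>I. X i x = k i}"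
      using k by (force simp: PiE_def extensional_def restrict_def fun_eq_iff)
    also have "emeasure M \<dots> = (\<Prod>i\<in>I. emeasure M {x \<in> space M. X i x = k i})"
      by (rule joint)
    also have "\<dots> = (\<Prod>i\<in>I. emeasure (D' i) {k i})"
      by (intro prod.cong refl)
         (simp add: D'_def D_def emeasure_distr rv vimage_def Int_def conj_commute)
    also have "\<dots> = emeasure (\<Pi>\<^sub>M i\<in>I. D' i) (\<Pi>\<^sub>E i\<in>I. {k i})"
      using assms(1) by (intro D'.emeasure_PiM [symmetric]) (auto simp: D'_def D_def)
    also have "(\<Pi>\<^sub>E i\<in>I. {k i}) = {k}"
      using k by (intro PiE_singleton) (simp add: PiE_def)
    also have "(\<Pi>\<^sub>M i\<in>I. D' i) = (\<Pi>\<^sub>M i\<in>I. D i)"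
      by (intro PiM_cong) (simp_all add: D'_def)
    finally show "emeasure (distr M (\<Pi>\<^sub>M i\<in>I. count_space UNIV) (\<lambda>x. \<lambda>i\<in>I. X i x)) {k} =
        emeasure (\<Pi>\<^sub>M i\<in>I. D i) {k}" .
  qed
  then show ?thesis
    using False unfolding D_def by (subst indep_vars_iff_distr_eq_PiM') (auto simp: rv)
qed

text \<open>
  This is conditioning on \<open>Y\<close>: the joint law of independent variables is the product of their
  laws, so by Fubini's theorem \<open>Y\<close> may be frozen at an independently drawn outcome \<open>w\<close>.
\<close>

lemma (in prob_space) emeasure_indep_var_eq_nn_integral:
  assumes ind: "indep_var S X T Y" and A: "A \<in> sets (S \<Otimes>\<^sub>M T)"
  shows "emeasure M {x \<in> space M. (X x, Y x) \<in> A} =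
         (\<integral>\<^sup>+ w. emeasure M {x \<in> space M. (X x, Y w) \<in> A} \<partial>M)"
proof -
  have X [measurable]: "X \<in> measurable M S" and Y [measurable]: "Y \<in> measurable M T"
    and eq: "distr M S X \<Otimes>\<^sub>M distr M T Y = distr M (S \<Otimes>\<^sub>M T) (\<lambda>x. (X x, Y x))"
    using ind by (auto simp: indep_var_distribution_eq)
  interpret DX: prob_space "distr M S X" by (rule prob_space_distr) (rule X)
  interpret DY: prob_space "distr M T Y" by (rule prob_space_distr) (rule Y)
  interpret P: pair_sigma_finite "distr M S X" "distr M T Y" ..
  have A': "A \<in> sets (distr M S X \<Otimes>\<^sub>M distr M T Y)"
    using A by (simp cong: sets_pair_measure_cong)
  have slice [measurable]: "(\<lambda>y. emeasure (distr M S X) ((\<lambda>x. (x, y)) -` A)) \<in> borel_measurable T"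
    using P.measurable_emeasure_Pair2[OF A'] by simp
  have "emeasure M {x \<in> space M. (X x, Y x) \<in> A} = emeasure (distr M (S \<Otimes>\<^sub>M T) (\<lambda>x. (X x, Y x))) A"
    using A by (subst emeasure_distr) (auto intro!: arg_cong[where f="emeasure M"])
  also have "\<dots> = (\<integral>\<^sup>+ y. emeasure (distr M S X) ((\<lambda>x. (x, y)) -` A) \<partial>distr M T Y)"
    unfolding eq [symmetric] by (rule P.emeasure_pair_measure_alt2[OF A'])
  also have "\<dots> = (\<integral>\<^sup>+ w. emeasure (distr M S X) ((\<lambda>x. (x, Y w)) -` A) \<partial>M)"
    by (rule nn_integral_distr) measurable
  also have "\<dots> = (\<integral>\<^sup>+ w. emeasure M {x \<in> space M. (X x, Y w) \<in> A} \<partial>M)"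
    using sets_Pair2[OF A]
    by (intro nn_integral_cong)
       (auto simp: emeasure_distr intro!: arg_cong[where f="emeasure M"])
  finally show ?thesis .
qed

section \<open>Increments of a Poisson process\<close>

lemma partition_nonneg:
  fixes t :: "nat \<Rightarrow> real"
  assumes "0 \<le> t 0" "\<And>i. i < n \<Longrightarrow> t i \<le> t (Suc i)" "i \<le> n"
  shows "0 \<le> t i"
  using assms(3) by (induction i) (use assms(1,2) in \<open>auto intro: order_trans\<close>)

text \<open>
  The facts about \<open>poisson_pmf\<close> assume a positive rate. Rate zero has to be covered since \<open>N1\<close> is observed
  over an interval of length zero whenever \<open>N2\<close> has no event.
\<close>

definition poisson_law :: "real \<Rightarrow> nat pmf" where
  "poisson_law r = (if r = 0 then return_pmf 0 else poisson_pmf r)"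

lemma pmf_poisson_law: "r \<ge> 0 \<Longrightarrow> pmf (poisson_law r) k = r ^ k / fact k * exp (- r)"
  by (auto simp: poisson_law_def power_0_left indicator_def)

context prob_space
begin

lemma poisson_process_increment_distr:
  assumes "poisson_process r N" "0 \<le> a" "a \<le> b"
  shows "distr M (count_space UNIV) (\<lambda>x. N b x - N a x) = measure_pmf (poisson_law (r * (b - a)))"
proof (cases "a = b")
  case True
  then show ?thesis
    by (simp add: poisson_law_def distr_const return_pmf.rep_eq)
next
  case False
  have "r > 0" and "\<forall>t\<ge>0. \<forall>s>0. distr M (count_space UNIV) (\<lambda>x. N (t + s) x - N t x) =
                  measure_pmf (poisson_pmf (r * s))"
    using assms(1) by (auto simp: poisson_process_def)
  from this(2)[rule_format, of a "b - a"] this(1) False assms(2,3) show ?thesis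
    by (simp add: poisson_law_def)
qed

text \<open>
  Stated for arbitrary factors \<open>f i\<close> because it serves both processes: indicator functions give the
  joint law of the increments of \<open>N1\<close>, and Poisson weights with rates proportional to the increments
  average that joint law over \<open>N2\<close>.
\<close>

lemma poisson_process_nn_integral_prod:
  fixes f :: "nat \<Rightarrow> nat \<Rightarrow> ennreal" and t :: "nat \<Rightarrow> real"
  assumes N: "poisson_process r N" and t: "0 \<le> t 0" "\<And>i. i < n \<Longrightarrow> t i \<le> t (Suc i)"
  shows "(\<integral>\<^sup>+ x. (\<Prod>i<n. f i (N (t (Suc i)) x - N (t i) x)) \<partial>M) =
         (\<Prod>i<n. \<integral>\<^sup>+ m. f i m \<partial>measure_pmf (poisson_law (r * (t (Suc i) - t i))))"
proof -
  have t_nonneg: "0 \<le> t i" if "i \<le> n" for i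
    using t that by (rule partition_nonneg)
  have rv: "N u \<in> measurable M (count_space UNIV)" if "u \<ge> 0" for u
    using N that by (auto simp: poisson_process_def counting_process_def)
  have "indep_vars (\<lambda>_. count_space UNIV) (\<lambda>i x. N (t (Suc i)) x - N (t i) x) {..<n}"
    using N t by (auto simp: poisson_process_def independent_increments_def)
  then have "indep_vars (\<lambda>_. borel) (\<lambda>i x. f i (N (t (Suc i)) x - N (t i) x)) {..<n}"
    by (rule indep_vars_compose2) simp
  then have "(\<integral>\<^sup>+ x. (\<Prod>i<n. f i (N (t (Suc i)) x - N (t i) x)) \<partial>M) =
      (\<Prod>i<n. \<integral>\<^sup>+ x. f i (N (t (Suc i)) x - N (t i) x) \<partial>M)"
    by (intro indep_vars_nn_integral) auto
  also have "\<dots> = (\<Prod>i<n. \<integral>\<^sup>+ m. f i m \<partial>measure_pmf (poisson_law (r * (t (Suc i) - t i))))"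
  proof (intro prod.cong refl)
    fix i assume i: "i \<in> {..<n}"
    have [measurable]: "N (t i) \<in> measurable M (count_space UNIV)"
      "N (t (Suc i)) \<in> measurable M (count_space UNIV)"
      using i by (auto intro!: rv t_nonneg)
    show "(\<integral>\<^sup>+ x. f i (N (t (Suc i)) x - N (t i) x) \<partial>M) =
        (\<integral>\<^sup>+ m. f i m \<partial>measure_pmf (poisson_law (r * (t (Suc i) - t i))))"
      using i t_nonneg t(2)
      by (subst poisson_process_increment_distr[OF N, symmetric]) (auto simp: nn_integral_distr)
  qed
  finally show ?thesis .
qed

lemma poisson_process_emeasure_increments:
  fixes k :: "nat \<Rightarrow> nat" and t :: "nat \<Rightarrow> real"
  assumes N: "poisson_process r N" and t: "0 \<le> t 0" "\<And>i. i < n \<Longrightarrow> t i \<le> t (Suc i)"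
  shows "emeasure M {x \<in> space M. \<forall>i<n. N (t (Suc i)) x - N (t i) x = k i} =
         (\<Prod>i<n. ennreal (pmf (poisson_law (r * (t (Suc i) - t i))) (k i)))"
proof -
  have t_nonneg: "0 \<le> t i" if "i \<le> n" for i
    using t that by (rule partition_nonneg)
  have [measurable]: "N (t i) \<in> measurable M (count_space UNIV)" if "i \<le> n" for i
    using N t_nonneg[OF that] by (auto simp: poisson_process_def counting_process_def)
  have "{x \<in> space M. \<forall>i<n. N (t (Suc i)) x - N (t i) x = k i} =
      {x \<in> space M. \<forall>i\<in>{..<n}. N (t (Suc i)) x - N (t i) x = k i}" (is "?E = _")
    by auto
  also have "\<dots> \<in> sets M"
    by (intro sets.sets_Collect_finite_All) auto
  finally have E: "?E \<in> sets M" .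
  have "emeasure M ?E = (\<integral>\<^sup>+ x. indicator ?E x \<partial>M)"
    using E by simp
  also have "\<dots> = (\<integral>\<^sup>+ x. (\<Prod>i<n. indicator {k i} (N (t (Suc i)) x - N (t i) x)) \<partial>M)"
    by (intro nn_integral_cong) (auto simp: indicator_def prod_zero_iff)
  also have "\<dots> = (\<Prod>i<n. \<integral>\<^sup>+ m. indicator {k i} m \<partial>measure_pmf (poisson_law (r * (t (Suc i) - t i))))"
    by (rule poisson_process_nn_integral_prod[OF N t, where f="\<lambda>i. indicator {k i}"])
  finally show ?thesis
    by (simp add: emeasure_pmf_single)
qed

end

section \<open>Joint law of the increments of the iterated process\<close>

text \<open>
  The law of a Poisson number of independent Poisson variables of rate \<open>\<nu>\<close> each, that is, a compound
  Poisson law; \<open>r\<close> is the mean number of events of the inner process.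
\<close>

definition iterated_law :: "real \<Rightarrow> real \<Rightarrow> nat pmf" where
  "iterated_law \<nu> r = bind_pmf (poisson_law r) (\<lambda>m. poisson_law (\<nu> * real m))"

context prob_space
begin

lemma measurable_iterated:
  fixes N1 N2 :: "real \<Rightarrow> 'a \<Rightarrow> nat"
  assumes "counting_process N1" "counting_process N2" "t \<ge> 0"
  shows "(\<lambda>x. N1 (real (N2 t x)) x) \<in> measurable M (count_space UNIV)"
proof (rule measurable_compose_countable[where f="\<lambda>m. N1 (real m)" and g="N2 t"])
  show "N1 (real m) \<in> measurable M (count_space UNIV)" for m
    using assms(1) by (simp add: counting_process_def)
  show "N2 t \<in> measurable M (count_space UNIV)"
    using assms(2,3) by (simp add: counting_process_def)
qed

text \<open>
  Applied twice, the product formula for Poisson increments gives this: once to \<open>N1\<close> on the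
  partition formed by the frozen values of \<open>N2\<close>, and once to \<open>N2\<close> when these values are averaged.
\<close>

lemma iterated_poisson_emeasure_increments:
  fixes k :: "nat \<Rightarrow> nat" and t :: "nat \<Rightarrow> real"
  assumes N1: "poisson_process \<nu> N1" and N2: "poisson_process \<omega> N2"
    and ind: "independent_processes N1 N2"
    and t: "0 \<le> t 0" "\<And>i. i < n \<Longrightarrow> t i \<le> t (Suc i)"
  shows "emeasure M {x \<in> space M. \<forall>i<n. N1 (real (N2 (t (Suc i)) x)) x - N1 (real (N2 (t i) x)) x = k i} =
         (\<Prod>i<n. ennreal (pmf (iterated_law \<nu> (\<omega> * (t (Suc i) - t i))) (k i)))"
proof -
  let ?P = "PiM {0..} (\<lambda>_. count_space UNIV) :: (real \<Rightarrow> nat) measure"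
  let ?X = "\<lambda>x. \<lambda>u\<in>{0..}. N1 u x" and ?Y = "\<lambda>x. \<lambda>u\<in>{0..}. N2 u x"
  define A where "A = {p \<in> space (?P \<Otimes>\<^sub>M ?P). \<forall>i\<in>{..<n}.
      fst p (real (snd p (t (Suc i)))) - fst p (real (snd p (t i))) = k i}"
  have t_nonneg: "0 \<le> t i" if "i \<le> n" for i
    using t that by (rule partition_nonneg)
  have mono: "N2 (t i) x \<le> N2 (t (Suc i)) x" if "i < n" "x \<in> space M" for i x
    using N2 that t_nonneg[of i] t_nonneg[of "Suc i"] t(2)[of i]
    by (auto simp: poisson_process_def counting_process_def mono_on_def)
  \<comment> \<open>Evaluating a path at a random time is not measurable for the product sigma-algebra in general;
    here the random time takes only countably many values.\<close>
  have eval: "(\<lambda>p. fst p (real (snd p u))) \<in> measurable (?P \<Otimes>\<^sub>M ?P) (count_space UNIV)"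
    if "u \<ge> 0" for u
  proof (rule measurable_compose_countable[where f="\<lambda>m p. fst p (real m)" and g="\<lambda>p. snd p u"])
    show "(\<lambda>p. fst p (real m)) \<in> measurable (?P \<Otimes>\<^sub>M ?P) (count_space UNIV)" for m
      by (rule measurable_compose[OF measurable_fst measurable_component_singleton]) simp
    show "(\<lambda>p. snd p u) \<in> measurable (?P \<Otimes>\<^sub>M ?P) (count_space UNIV)"
      by (rule measurable_compose[OF measurable_snd measurable_component_singleton])
         (use that in simp)
  qed
  have A: "A \<in> sets (?P \<Otimes>\<^sub>M ?P)"
    unfolding A_def
  proof (intro sets.sets_Collect_finite_All)
    fix i assume "i \<in> {..<n}"
    then have [measurable]:
      "(\<lambda>p. fst p (real (snd p (t i)))) \<in> measurable (?P \<Otimes>\<^sub>M ?P) (count_space UNIV)"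
      "(\<lambda>p. fst p (real (snd p (t (Suc i))))) \<in> measurable (?P \<Otimes>\<^sub>M ?P) (count_space UNIV)"
      by (auto intro!: eval t_nonneg)
    show "{p \<in> space (?P \<Otimes>\<^sub>M ?P).
        fst p (real (snd p (t (Suc i)))) - fst p (real (snd p (t i))) = k i} \<in> sets (?P \<Otimes>\<^sub>M ?P)"
      by measurable
  qed simp
  have mem_A: "(?X x, ?Y w) \<in> A \<longleftrightarrow>
      (\<forall>i<n. N1 (real (N2 (t (Suc i)) w)) x - N1 (real (N2 (t i) w)) x = k i)" for x w
    using t_nonneg by (auto simp: A_def space_pair_measure space_PiM)
  have "emeasure M {x \<in> space M. \<forall>i<n. N1 (real (N2 (t (Suc i)) x)) x - N1 (real (N2 (t i) x)) x = k i} =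
      (\<integral>\<^sup>+ w. emeasure M {x \<in> space M. \<forall>i<n. N1 (real (N2 (t (Suc i)) w)) x - N1 (real (N2 (t i) w)) x = k i} \<partial>M)"
    using emeasure_indep_var_eq_nn_integral[OF ind[unfolded independent_processes_def] A]
    unfolding mem_A .
  also have "\<dots> = (\<integral>\<^sup>+ w. (\<Prod>i<n. ennreal (pmf (poisson_law (\<nu> * real (N2 (t (Suc i)) w - N2 (t i) w))) (k i))) \<partial>M)"
  proof (intro nn_integral_cong)
    fix w assume w: "w \<in> space M"
    show "emeasure M {x \<in> space M. \<forall>i<n. N1 (real (N2 (t (Suc i)) w)) x - N1 (real (N2 (t i) w)) x = k i} =
        (\<Prod>i<n. ennreal (pmf (poisson_law (\<nu> * real (N2 (t (Suc i)) w - N2 (t i) w))) (k i)))"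
      using poisson_process_emeasure_increments[OF N1, of "\<lambda>i. real (N2 (t i) w)" n k] mono[OF _ w]
      by (simp add: of_nat_diff)
  qed
  also have "\<dots> = (\<Prod>i<n. \<integral>\<^sup>+ m. ennreal (pmf (poisson_law (\<nu> * real m)) (k i))
      \<partial>measure_pmf (poisson_law (\<omega> * (t (Suc i) - t i))))"
    by (rule poisson_process_nn_integral_prod[OF N2 t,
          where f="\<lambda>i m. ennreal (pmf (poisson_law (\<nu> * real m)) (k i))"])
  finally show ?thesis
    by (simp add: iterated_law_def ennreal_pmf_bind)
qed

lemma iterated_poisson_emeasure_increment:
  assumes N1: "poisson_process \<nu> N1" and N2: "poisson_process \<omega> N2"
    and ind: "independent_processes N1 N2" and ab: "0 \<le> a" "a \<le> b"
  shows "emeasure M {x \<in> space M. N1 (real (N2 b x)) x - N1 (real (N2 a x)) x = k} =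
         ennreal (pmf (iterated_law \<nu> (\<omega> * (b - a))) k)"
  using iterated_poisson_emeasure_increments[OF N1 N2 ind, of "\<lambda>i. if i = 0 then a else b" 1 "\<lambda>_. k"] ab
  by simp

end

section \<open>The iterated law at small times\<close>

text \<open>
  Write the weight as a sum over the number \<open>m\<close> of events of the inner process. The first summand of
  the bound is the error made by replacing \<open>P(m = 1) = r exp (- r)\<close> by \<open>r\<close>, and the second one is
  \<open>P(m \<ge> 2)\<close>. Both are of order \<open>r\<^sup>2\<close>.
\<close>

lemma iterated_law_expansion:
  fixes \<nu> r :: real
  assumes "\<nu> > 0" "r > 0" "k \<ge> 1"
  shows "\<bar>pmf (iterated_law \<nu> r) k - r * exp (- \<nu>) * \<nu> ^ k / fact k\<bar>
           \<le> r * (1 - exp (- r)) + (1 - exp (- r) - r * exp (- r))"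
proof -
  define q where "q m = pmf (poisson_law (\<nu> * real m)) k" for m
  define p where "p = pmf (poisson_law r)"
  have q0: "q 0 = 0" and q1: "q 1 = \<nu> ^ k / fact k * exp (- \<nu>)"
    using assms by (auto simp: q_def pmf_poisson_law power_0_left)
  have q_bounds: "0 \<le> q m" "q m \<le> 1" for m
    by (auto simp: q_def pmf_le_1)
  have p01: "p 0 = exp (- r)" "p 1 = r * exp (- r)"
    using assms by (auto simp: p_def pmf_poisson_law)
  have int_q: "integrable (measure_pmf (poisson_law r)) q"
    by (rule measure_pmf.integrable_const_bound[where B=1]) (use q_bounds in auto)
  have int_single: "integrable (measure_pmf (poisson_law r)) (\<lambda>m. indicator {j} m * c)" for j and c :: real
    by (rule measure_pmf.integrable_const_bound[where B="\<bar>c\<bar>"]) (auto split: split_indicator)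
  have single: "(\<integral>m. indicator {j} m * c \<partial>measure_pmf (poisson_law r)) = p j * c" for j and c :: real
    by (simp add: p_def measure_pmf_single)
  have "pmf (iterated_law \<nu> r) k = (\<integral>m. q m \<partial>measure_pmf (poisson_law r))"
    by (simp add: iterated_law_def pmf_bind q_def)
  also have "\<dots> = (\<integral>m. indicator {1} m * q 1 + (q m - indicator {1} m * q 1) \<partial>measure_pmf (poisson_law r))"
    by simp
  also have "\<dots> = p 1 * q 1 + (\<integral>m. (q m - indicator {1} m * q 1) \<partial>measure_pmf (poisson_law r))"
    unfolding single [symmetric]
    by (intro Bochner_Integration.integral_add Bochner_Integration.integrable_diff int_q int_single)
  finally have eq: "pmf (iterated_law \<nu> r) k =
      p 1 * q 1 + (\<integral>m. (q m - indicator {1} m * q 1) \<partial>measure_pmf (poisson_law r))" .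
  have R_nonneg: "0 \<le> (\<integral>m. (q m - indicator {1} m * q 1) \<partial>measure_pmf (poisson_law r))"
    using q_bounds by (intro Bochner_Integration.integral_nonneg) (auto split: split_indicator)
  have "(\<integral>m. (q m - indicator {1} m * q 1) \<partial>measure_pmf (poisson_law r)) \<le>
      (\<integral>m. 1 - indicator {0} m * 1 - indicator {1} m * 1 \<partial>measure_pmf (poisson_law r))"
    using q_bounds q0
    by (intro integral_mono Bochner_Integration.integrable_diff int_q int_single)
       (auto split: split_indicator)
  also have "\<dots> = (\<integral>m. 1 \<partial>measure_pmf (poisson_law r)) - p 0 * 1 - p 1 * 1"
    unfolding single [symmetric]
    by (subst Bochner_Integration.integral_diff;
        (intro Bochner_Integration.integrable_diff int_single measure_pmf.integrable_const)?)+ simp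
  finally have R_le: "(\<integral>m. (q m - indicator {1} m * q 1) \<partial>measure_pmf (poisson_law r)) \<le> 1 - p 0 - p 1"
    by (simp add: measure_pmf.prob_space)
  have "0 \<le> r * (1 - exp (- r)) * q 1" "r * (1 - exp (- r)) * q 1 \<le> r * (1 - exp (- r)) * 1"
    using q_bounds[of 1] assms by (auto intro!: mult_nonneg_nonneg mult_left_mono)
  moreover have "r * exp (- \<nu>) * \<nu> ^ k / fact k = r * q 1"
    unfolding q1 by simp
  then have "pmf (iterated_law \<nu> r) k - r * exp (- \<nu>) * \<nu> ^ k / fact k =
      (\<integral>m. (q m - indicator {1} m * q 1) \<partial>measure_pmf (poisson_law r)) - r * (1 - exp (- r)) * q 1"
    unfolding eq p01 by (simp add: algebra_simps)
  ultimately show ?thesis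
    using R_nonneg R_le unfolding p01 by linarith
qed

lemma iterated_law_small_time:
  assumes "\<nu> > 0" "\<omega> > 0" "k \<ge> 1"
  shows "\<exists>f :: real \<Rightarrow> real. ((\<lambda>s. f s / s) \<longlongrightarrow> 0) (at 0) \<and>
    (\<forall>s>0. pmf (iterated_law \<nu> (\<omega> * s)) k = \<omega> * exp (- \<nu>) * s * \<nu> ^ k / fact k + f s)"
proof (intro exI conjI allI impI)
  \<comment> \<open>The limit at \<open>0\<close> is two-sided, so the error term is extended by zero to negative times.\<close>
  define f where "f s = (if s > 0 then pmf (iterated_law \<nu> (\<omega> * s)) k -
      \<omega> * exp (- \<nu>) * s * \<nu> ^ k / fact k else 0)" for s
  define h where "h s = (\<omega> * s * (1 - exp (- (\<omega> * s))) +
      (1 - exp (- (\<omega> * s)) - \<omega> * s * exp (- (\<omega> * s)))) / s" for s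
  show "pmf (iterated_law \<nu> (\<omega> * s)) k = \<omega> * exp (- \<nu>) * s * \<nu> ^ k / fact k + f s"
    if "s > 0" for s
    using that by (simp add: f_def)
  have "((\<lambda>s. f s / s) \<longlongrightarrow> 0) (at_right 0)"
  proof (rule Lim_null_comparison)
    show "(h \<longlongrightarrow> 0) (at_right 0)"
      using assms unfolding h_def by real_asymp
    show "\<forall>\<^sub>F s in at_right 0. norm (f s / s) \<le> h s"
      using eventually_at_right_less
    proof (rule eventually_mono)
      fix s :: real assume s: "0 < s"
      then have "\<bar>f s\<bar> \<le> h s * s"
        using iterated_law_expansion[of \<nu> "\<omega> * s" k] assms by (simp add: f_def h_def mult_ac)
      then show "norm (f s / s) \<le> h s"
        using s by (simp add: divide_le_eq)
    qed
  qed
  moreover have "((\<lambda>s. f s / s) \<longlongrightarrow> 0) (at_left 0)"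
    by (rule tendsto_eventually)
       (auto simp: f_def eventually_at_filter)
  ultimately show "((\<lambda>s. f s / s) \<longlongrightarrow> 0) (at 0)"
    by (simp add: filterlim_at_split)
qed

section \<open>The iterated Poisson process is a Bell-Touchard process\<close>

theorem theorem3p3:
  fixes M :: "'a measure" and \<nu> \<omega> :: real and N1 N2 :: "real \<Rightarrow> 'a \<Rightarrow> nat"
  assumes "prob_space M"
    and "\<nu> > 0" and "\<omega> > 0"
    and "prob_space.poisson_process M \<nu> N1"
    and "prob_space.poisson_process M \<omega> N2"
    and "prob_space.independent_processes M N1 N2"
  shows "prob_space.bell_touchard_process M (\<omega> * exp (- \<nu>)) \<nu> (\<lambda>t x. N1 (real (N2 t x)) x)"
proof -
  interpret prob_space M by fact
  note N1 = assms(4) and N2 = assms(5) and ind = assms(6)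
  define N where "N t x = N1 (real (N2 t x)) x" for t x
  have count: "counting_process N1" "counting_process N2"
    using N1 N2 by (auto simp: poisson_process_def)
  have rv: "N t \<in> measurable M (count_space UNIV)" if "t \<ge> 0" for t
    unfolding N_def using count that by (rule measurable_iterated)
  have increment: "emeasure M {x \<in> space M. N b x - N a x = k} =
      ennreal (pmf (iterated_law \<nu> (\<omega> * (b - a))) k)" if "0 \<le> a" "a \<le> b" for a b k
    unfolding N_def by (rule iterated_poisson_emeasure_increment[OF N1 N2 ind that])
  have "counting_process N"
    unfolding counting_process_def
  proof (intro conjI allI impI ballI)
    show "N t \<in> measurable M (count_space UNIV)" if "t \<ge> 0" for t
      by (rule rv) fact
    show "mono_on {0..} (\<lambda>t. N t x)" if "x \<in> space M" for x
    proof (rule mono_onI)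
      fix s t :: real assume "s \<in> {0..}" "t \<in> {0..}" "s \<le> t"
      then have "N2 s x \<le> N2 t x"
        using count(2) that by (auto simp: counting_process_def mono_on_def)
      then show "N s x \<le> N t x"
        using count(1) that by (auto simp: N_def counting_process_def mono_on_def)
    qed
  qed
  moreover have "\<forall>x\<in>space M. N 0 x = 0"
    using N1 N2 by (auto simp: N_def poisson_process_def)
  moreover have "stationary_increments N"
  proof -
    have "distr M (count_space UNIV) (\<lambda>x. N (t + s) x - N t x) = measure_pmf (iterated_law \<nu> (\<omega> * s))"
      if "s \<ge> 0" "t \<ge> 0" for s t
    proof (rule measure_eqI_countable[where A=UNIV])
      fix k
      have [measurable]: "N (t + s) \<in> measurable M (count_space UNIV)"
        "N t \<in> measurable M (count_space UNIV)"
        using that by (auto intro!: rv)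
      have "emeasure (distr M (count_space UNIV) (\<lambda>x. N (t + s) x - N t x)) {k} =
          emeasure M {x \<in> space M. N (t + s) x - N t x = k}"
        by (subst emeasure_distr) (auto intro!: arg_cong[where f="emeasure M"])
      then show "emeasure (distr M (count_space UNIV) (\<lambda>x. N (t + s) x - N t x)) {k} =
          emeasure (measure_pmf (iterated_law \<nu> (\<omega> * s))) {k}"
        using that by (simp add: increment emeasure_pmf_single)
    qed auto
    then show ?thesis
      by (simp add: stationary_increments_def)
  qed
  moreover have "independent_increments N"
    unfolding independent_increments_def
  proof (intro allI impI)
    fix n :: nat and t :: "nat \<Rightarrow> real"
    assume t: "0 \<le> t 0" "\<forall>i<n. t i \<le> t (Suc i)"
    have t_nonneg: "0 \<le> t i" if "i \<le> n" for i
      using t that by (auto intro: partition_nonneg[of t n i])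
    show "indep_vars (\<lambda>_. count_space UNIV) (\<lambda>i x. N (t (Suc i)) x - N (t i) x) {..<n}"
    proof (rule indep_vars_count_spaceI)
      fix i assume i: "i \<in> {..<n}"
      have [measurable]: "N (t (Suc i)) \<in> measurable M (count_space UNIV)"
        "N (t i) \<in> measurable M (count_space UNIV)"
        using i by (auto intro!: rv t_nonneg)
      show "(\<lambda>x. N (t (Suc i)) x - N (t i) x) \<in> measurable M (count_space UNIV)"
        by measurable
    next
      fix k :: "nat \<Rightarrow> nat"
      have "emeasure M {x \<in> space M. \<forall>i\<in>{..<n}. N (t (Suc i)) x - N (t i) x = k i} =
          (\<Prod>i<n. ennreal (pmf (iterated_law \<nu> (\<omega> * (t (Suc i) - t i))) (k i)))"
        using iterated_poisson_emeasure_increments[OF N1 N2 ind, of t n k] t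
        by (simp add: N_def Ball_def)
      then show "emeasure M {x \<in> space M. \<forall>i\<in>{..<n}. N (t (Suc i)) x - N (t i) x = k i} =
          (\<Prod>i<n. emeasure M {x \<in> space M. N (t (Suc i)) x - N (t i) x = k i})"
        using t t_nonneg by (simp add: increment)
    qed simp
  qed
  moreover have "\<exists>f :: real \<Rightarrow> real. ((\<lambda>s. f s / s) \<longlongrightarrow> 0) (at 0) \<and>
      (\<forall>s>0. prob {x \<in> space M. N (t + s) x - N t x = k} = \<omega> * exp (- \<nu>) * s * \<nu> ^ k / fact k + f s)"
    if "k \<ge> 1" "t > 0" for k t
  proof -
    have "prob {x \<in> space M. N (t + s) x - N t x = k} = pmf (iterated_law \<nu> (\<omega> * s)) k"
      if "s > 0" for s
      using increment[of t "t + s" k] that \<open>t > 0\<close> by (simp add: measure_def)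
    then show ?thesis
      using iterated_law_small_time[OF assms(2,3) \<open>k \<ge> 1\<close>] by simp
  qed
  ultimately have "bell_touchard_process (\<omega> * exp (- \<nu>)) \<nu> N"
    using assms(2,3) by (simp add: bell_touchard_process_def)
  then show ?thesis
    by (simp add: N_def [abs_def])
qed

end
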